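(* Let $k \geq 1$ be given, and suppose there are nonzero operators $L = M_0$, $A_1, A_2,\dots, A_k$, $M = M_1, M_2, \dots, M_{k+1}$ in $K[\partial_t,\partial_{x_1},\dots,\partial_{x_n}]$ so that $$M_{i-1} = A_i M_i + M_{i+1}\qquad\text{for } 1 \leq i \leq k,$$ and there are a function $c\in K$ and an operator $B$ with $$M_{k+1} = cB \notin K\qquad\text{and}\qquad M_k B = B M_k .$$ Then we can define a Darboux transformation $NL = L_1M$ as follows. Define $N_{k+1} = M_{k+1}$ and $N_{k} = c M_k c^{-1}$, and define $N_i$ for $0 \leq i \leq k-1$ by downward recursion using $N_i = N_{i+1}A_{i+1} + N_{i+2}$. Finally let $N = N_1$, and let $L_1 = N_0$. Then $M$ and $N$ have the same principal symbol, and $NL = L_1M$ is a Darboux transformation.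
   Context: $K$ is a differential field of characteristic zero with commuting derivations $\partial_t,\partial_{x_1},\dots,\partial_{x_n}$, and $K[\partial_t,\partial_{x_1},\dots,\partial_{x_n}]$ is the ring of linear partial differential operators over $K$. Elements of $K$ are called functions. $\sigma(L)$ denotes the principal symbol of $L$. A Darboux transformation $(M,N)\colon L\to L_1$ (also referred to by its relation $NL=L_1M$), where $\sigma(L)=\sigma(L_1)$, is a pair of operators $(M,N)$ satisfying $NL=L_1M$. *)

theory Defs
  imports Complex_Main "HOL-Library.Poly_Mapping"
begin

text \<open>
  A differential field of characteristic zero with finitely many commuting derivations
  \<open>D i\<close>. The index type \<open>'i\<close> is an arbitrary finite type; the derivations
  \<open>\<partial>\<^sub>t, \<partial>\<^sub>x\<^sub>1, \<dots>, \<partial>\<^sub>x\<^sub>n\<close> correspond to \<open>CARD('i) = n + 1\<close>. Nothing else is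
  assumed about them: they may be linearly dependent over the field, so operators have to be
  formal objects and not maps from the field to itself.
\<close>

locale differential_field =
  fixes D :: "'i::finite \<Rightarrow> 'k::field_char_0 \<Rightarrow> 'k"
  assumes D_add: "D i (f + g) = D i f + D i g"
    and D_mult: "D i (f * g) = D i f * g + f * D i g"
    and D_commute: "D i (D j f) = D j (D i f)"


section \<open>Linear partial differential operators\<close>

text \<open>
  The operator \<open>\<Sum>\<^sub>\<alpha> a\<^sub>\<alpha> \<partial>\<^sup>\<alpha>\<close> is represented by the finitely supported family of its
  coefficients. Addition of operators is addition in \<^typ>\<open>('i \<Rightarrow>\<^sub>0 nat) \<Rightarrow>\<^sub>0 'k\<close>, but the
  library product \<open>*\<close> on this type is the product of the commutative polynomial ring
  \<open>K[\<xi>]\<close> with \<open>\<xi>\<^sub>i\<close> in place of \<open>\<partial>\<^sub>i\<close>; it is the ring in which symbols live and is not the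
  composition of operators.
\<close>

type_synonym ('i, 'k) diffop = "('i \<Rightarrow>\<^sub>0 nat) \<Rightarrow>\<^sub>0 'k"

definition fun_op :: "'k \<Rightarrow> ('i, 'k::zero) diffop"
  where "fun_op f = Poly_Mapping.single 0 f"

definition partial_op :: "'i \<Rightarrow> ('i, 'k::zero_neq_one) diffop"
  where "partial_op i = Poly_Mapping.single (Poly_Mapping.single i 1) 1"

text \<open>
  Left composition with \<open>\<partial>\<^sub>i\<close>, by the rule
  \<open>\<partial>\<^sub>i b \<partial>\<^sup>\<beta> = D\<^sub>i(b) \<partial>\<^sup>\<beta> + b \<partial>\<^sub>i \<partial>\<^sup>\<beta>\<close>; in the second summand the commutative product
  only raises the exponent of \<open>\<partial>\<^sub>i\<close>.
\<close>

definition partial_comp ::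
    "('i \<Rightarrow> 'k \<Rightarrow> 'k) \<Rightarrow> 'i \<Rightarrow> ('i, 'k::field) diffop \<Rightarrow> ('i, 'k) diffop"
  where "partial_comp D i Q = Poly_Mapping.map (D i) Q + partial_op i * Q"

text \<open>
  Left composition with \<open>\<partial>\<^sup>\<alpha>\<close>; the order of the factors is immaterial because the maps
  \<^term>\<open>partial_comp D i\<close> commute.
\<close>

definition monom_comp ::
    "('i::finite \<Rightarrow> 'k \<Rightarrow> 'k) \<Rightarrow> ('i \<Rightarrow>\<^sub>0 nat) \<Rightarrow> ('i, 'k::field) diffop \<Rightarrow> ('i, 'k) diffop"
  where "monom_comp D \<alpha> Q =
    Finite_Set.fold (\<lambda>i. partial_comp D i ^^ Poly_Mapping.lookup \<alpha> i) Q UNIV"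

definition op_comp ::
    "('i, 'k) diffop \<Rightarrow> ('i::finite \<Rightarrow> 'k \<Rightarrow> 'k) \<Rightarrow> ('i, 'k::field) diffop \<Rightarrow> ('i, 'k) diffop"
    (\<open>_ \<odot>\<^bsub>_\<^esub> _\<close> [70, 0, 71] 70)
  where "P \<odot>\<^bsub>D\<^esub> Q =
    (\<Sum>\<alpha>\<in>Poly_Mapping.keys P. fun_op (Poly_Mapping.lookup P \<alpha>) * monom_comp D \<alpha> Q)"


section \<open>Order, principal symbol, Darboux transformations\<close>

definition multideg :: "('i::finite \<Rightarrow>\<^sub>0 nat) \<Rightarrow> nat"
  where "multideg \<alpha> = (\<Sum>i\<in>UNIV. Poly_Mapping.lookup \<alpha> i)"

text \<open>The junk value \<open>op_order 0 = 0\<close> only gives \<open>principal_symbol 0 = 0\<close>.\<close>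

definition op_order :: "('i::finite, 'k::zero) diffop \<Rightarrow> nat"
  where "op_order P = Max (insert 0 (multideg ` Poly_Mapping.keys P))"

text \<open>The part of highest total degree, an element of the polynomial ring \<open>K[\<xi>]\<close>.\<close>

definition principal_symbol :: "('i::finite, 'k::comm_monoid_add) diffop \<Rightarrow> ('i \<Rightarrow>\<^sub>0 nat) \<Rightarrow>\<^sub>0 'k"
  where "principal_symbol P =
    (\<Sum>\<alpha> \<in> {\<alpha> \<in> Poly_Mapping.keys P. multideg \<alpha> = op_order P}.
       Poly_Mapping.single \<alpha> (Poly_Mapping.lookup P \<alpha>))"

text \<open>\<open>(M, N)\<close> is a Darboux transformation from \<open>L\<close> to \<open>L\<^sub>1\<close>.\<close>

definition darboux_transformation ::
    "('i::finite \<Rightarrow> 'k \<Rightarrow> 'k) \<Rightarrow> ('i, 'k::field) diffop \<Rightarrow> ('i, 'k) diffop \<Rightarrow>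
     ('i, 'k) diffop \<Rightarrow> ('i, 'k) diffop \<Rightarrow> bool"
  where "darboux_transformation D M N L L\<^sub>1 \<longleftrightarrow>
    principal_symbol L = principal_symbol L\<^sub>1 \<and> N \<odot>\<^bsub>D\<^esub> L = L\<^sub>1 \<odot>\<^bsub>D\<^esub> M"


section \<open>The ring of operators\<close>

text \<open>
  The product \<^const>\<open>op_comp\<close> makes the operators an associative unital ring that contains the
  field and commuting elements \<open>\<partial>\<^sub>i\<close> with \<open>\<partial>\<^sub>i f = f \<partial>\<^sub>i + D\<^sub>i(f)\<close>, and every operator is a left
  linear combination of the monomials \<open>\<partial>\<^sup>\<alpha>\<close>.
\<close>

lemma diffop_induct [case_names zero single add]:
  fixes P :: "('i, 'k::comm_monoid_add) diffop"
  assumes "Q 0" "\<And>\<alpha> a. Q (Poly_Mapping.single \<alpha> a)" "\<And>p q. Q p \<Longrightarrow> Q q \<Longrightarrow> Q (p + q)"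
  shows "Q P"
proof (induction P rule: Poly_Mapping.update_induct)
  case const
  show ?case by (fact assms(1))
next
  case (update f a b)
  have "Poly_Mapping.update a b f = f + Poly_Mapping.single a b"
    using update by (intro poly_mapping_eqI)
      (auto simp: lookup_update lookup_add lookup_single in_keys_iff)
  with update assms show ?case by simp
qed

lemma op_comp_superset:
  assumes "finite S" "Poly_Mapping.keys P \<subseteq> S"
  shows "P \<odot>\<^bsub>D\<^esub> Q = (\<Sum>\<alpha>\<in>S. fun_op (Poly_Mapping.lookup P \<alpha>) * monom_comp D \<alpha> Q)"
  unfolding op_comp_def using assms
  by (intro sum.mono_neutral_left) (auto simp: in_keys_iff fun_op_def)

lemma op_comp_add_left: "(P + P') \<odot>\<^bsub>D\<^esub> Q = (P \<odot>\<^bsub>D\<^esub> Q) + (P' \<odot>\<^bsub>D\<^esub> Q)"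
proof -
  let ?S = "Poly_Mapping.keys P \<union> Poly_Mapping.keys P'"
  have "Poly_Mapping.keys (P + P') \<subseteq> ?S" by (rule keys_add)
  then show ?thesis
    by (simp add: op_comp_superset[where S = ?S] lookup_add fun_op_def single_add
        ring_distribs sum.distrib)
qed

lemma op_comp_zero_left [simp]: "0 \<odot>\<^bsub>D\<^esub> Q = 0"
  by (simp add: op_comp_def)

lemma op_comp_single: "Poly_Mapping.single \<alpha> a \<odot>\<^bsub>D\<^esub> Q = fun_op a * monom_comp D \<alpha> Q"
  by (cases "a = 0") (auto simp: op_comp_def fun_op_def)

context differential_field
begin

lemma D_0 [simp]: "D i 0 = 0"
  using D_add[of i 0 0] by simp

lemma D_1 [simp]: "D i 1 = 0"
  using D_mult[of i 1 1] by simp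

lemma lookup_map_D [simp]:
  "Poly_Mapping.lookup (Poly_Mapping.map (D i) Q) \<alpha> = D i (Poly_Mapping.lookup Q \<alpha>)"
  by (auto simp: Poly_Mapping.map.rep_eq when_def)

lemma map_D_add:
  "Poly_Mapping.map (D i) (P + Q) = Poly_Mapping.map (D i) P + Poly_Mapping.map (D i) Q"
  by (intro poly_mapping_eqI) (simp add: lookup_add D_add)

lemma map_D_0 [simp]: "Poly_Mapping.map (D i) 0 = 0"
  by (intro poly_mapping_eqI) simp

lemma map_D_single [simp]:
  "Poly_Mapping.map (D i) (Poly_Mapping.single \<alpha> a) = Poly_Mapping.single \<alpha> (D i a)"
  by (intro poly_mapping_eqI) (simp add: lookup_single when_def)

lemma map_D_commute:
  "Poly_Mapping.map (D i) (Poly_Mapping.map (D j) Q) =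
   Poly_Mapping.map (D j) (Poly_Mapping.map (D i) Q)"
  by (intro poly_mapping_eqI) (simp add: D_commute)

lemma map_D_mult:
  fixes P Q :: "('i, 'k) diffop"
  shows "Poly_Mapping.map (D i) (P * Q) = Poly_Mapping.map (D i) P * Q + P * Poly_Mapping.map (D i) Q"
proof (induction P rule: diffop_induct)
  case (single \<alpha> a)
  show ?case
    by (induction Q rule: diffop_induct)
       (simp_all add: mult_single D_mult single_add map_D_add ring_distribs)
qed (simp_all add: map_D_add ring_distribs)

lemma map_D_partial_op [simp]: "Poly_Mapping.map (D i) (partial_op j) = 0"
  by (simp add: partial_op_def)

lemma partial_comp_add: "partial_comp D i (P + Q) = partial_comp D i P + partial_comp D i Q"
  by (simp add: partial_comp_def map_D_add ring_distribs)

lemma partial_comp_0 [simp]: "partial_comp D i 0 = 0"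
  by (simp add: partial_comp_def)

lemma partial_comp_fun_mult:
  "partial_comp D i (fun_op f * Q) = fun_op (D i f) * Q + fun_op f * partial_comp D i Q"
  by (simp add: partial_comp_def map_D_mult fun_op_def ring_distribs mult.left_commute)

lemma partial_comp_commute:
  "partial_comp D i (partial_comp D j Q) = partial_comp D j (partial_comp D i Q)"
  by (simp add: partial_comp_def map_D_add map_D_mult ring_distribs map_D_commute[of i j]
      mult.left_commute)

lemma partial_comp_pow_commute1:
  "partial_comp D i ((partial_comp D j ^^ n) Q) = (partial_comp D j ^^ n) (partial_comp D i Q)"
  by (induction n) (simp_all add: partial_comp_commute[of i j])

lemma partial_comp_pow_commute:
  "(partial_comp D i ^^ m) ((partial_comp D j ^^ n) Q) =
   (partial_comp D j ^^ n) ((partial_comp D i ^^ m) Q)"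
  by (induction m) (simp_all add: partial_comp_pow_commute1)

lemma comp_fun_commute_partial_comp:
  "comp_fun_commute (\<lambda>i. partial_comp D i ^^ (n i))"
  by standard (auto simp: partial_comp_pow_commute)

lemma fold_partial_comp_insert:
  assumes "finite A" "i \<notin> A"
  shows "Finite_Set.fold (\<lambda>i. partial_comp D i ^^ n i) Q (insert i A) =
    (partial_comp D i ^^ n i) (Finite_Set.fold (\<lambda>i. partial_comp D i ^^ n i) Q A)"
proof -
  interpret comp_fun_commute "\<lambda>i. partial_comp D i ^^ n i"
    by (rule comp_fun_commute_partial_comp)
  show ?thesis using assms by (rule fold_insert)
qed

lemma fold_partial_comp_zero:
  assumes "finite A" "\<And>i. i \<in> A \<Longrightarrow> n i = 0"
  shows "Finite_Set.fold (\<lambda>i. partial_comp D i ^^ n i) Q A = Q"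
  using assms by (induction A) (simp_all add: fold_partial_comp_insert)

lemma fold_partial_comp_pow:
  assumes "finite A"
  shows "Finite_Set.fold (\<lambda>i. partial_comp D i ^^ n i) ((partial_comp D j ^^ m) Q) A =
    (partial_comp D j ^^ m) (Finite_Set.fold (\<lambda>i. partial_comp D i ^^ n i) Q A)"
  using assms
  by (induction A) (simp_all add: fold_partial_comp_insert partial_comp_pow_commute)

lemma fold_partial_comp_add:
  assumes "finite A"
  shows "Finite_Set.fold (\<lambda>i. partial_comp D i ^^ (m i + n i)) Q A =
    Finite_Set.fold (\<lambda>i. partial_comp D i ^^ m i)
      (Finite_Set.fold (\<lambda>i. partial_comp D i ^^ n i) Q A) A"
  using assms
proof (induction A)
  case (insert i A)
  show ?case
    by (simp only: fold_partial_comp_insert[OF insert.hyps]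
          fold_partial_comp_pow[OF insert.hyps(1)] insert.IH)
       (simp add: funpow_add)
qed simp

lemma monom_comp_0 [simp]: "monom_comp D 0 Q = Q"
  unfolding monom_comp_def by (rule fold_partial_comp_zero) simp_all

lemma monom_comp_add: "monom_comp D (\<alpha> + \<beta>) Q = monom_comp D \<alpha> (monom_comp D \<beta> Q)"
  by (simp only: monom_comp_def lookup_add fold_partial_comp_add[OF finite])

lemma monom_comp_single_1 [simp]: "monom_comp D (Poly_Mapping.single i 1) Q = partial_comp D i Q"
proof -
  let ?n = "Poly_Mapping.lookup (Poly_Mapping.single i (1::nat))"
  have "Finite_Set.fold (\<lambda>j. partial_comp D j ^^ ?n j) Q (insert i (UNIV - {i})) =
      (partial_comp D i ^^ ?n i) (Finite_Set.fold (\<lambda>j. partial_comp D j ^^ ?n j) Q (UNIV - {i}))"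
    by (rule fold_partial_comp_insert) simp_all
  also have "Finite_Set.fold (\<lambda>j. partial_comp D j ^^ ?n j) Q (UNIV - {i}) = Q"
    by (rule fold_partial_comp_zero) (auto simp: lookup_single_not_eq)
  finally show ?thesis by (simp add: monom_comp_def insert_absorb)
qed

lemma exponent_induct [case_names zero single]:
  fixes \<alpha> :: "'i \<Rightarrow>\<^sub>0 nat"
  assumes "R 0" "\<And>i \<beta>. R \<beta> \<Longrightarrow> R (Poly_Mapping.single i 1 + \<beta>)"
  shows "R \<alpha>"
proof -
  have s: "R (Poly_Mapping.single i n + \<beta>)" if "R \<beta>" for i n \<beta>
  proof (induction n)
    case (Suc n)
    have "Poly_Mapping.single i (Suc n) = Poly_Mapping.single i 1 + Poly_Mapping.single i n"
      by (simp flip: single_add)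
    with Suc assms(2) show ?case by (simp add: add.assoc)
  qed (use that in simp)
  show ?thesis
  proof (induction \<alpha> rule: Poly_Mapping.update_induct)
    case (update f a b)
    have "Poly_Mapping.update a b f = Poly_Mapping.single a b + f"
      using update by (intro poly_mapping_eqI)
        (auto simp: lookup_update lookup_add lookup_single in_keys_iff)
    with s[OF update(3)] show ?case by simp
  qed (fact assms(1))
qed

lemma monom_comp_plus: "monom_comp D \<alpha> (P + Q) = monom_comp D \<alpha> P + monom_comp D \<alpha> Q"
  by (induction \<alpha> rule: exponent_induct)
     (simp_all del: One_nat_def add: monom_comp_add partial_comp_add)

lemma op_comp_add_right: "P \<odot>\<^bsub>D\<^esub> (Q + Q') = (P \<odot>\<^bsub>D\<^esub> Q) + (P \<odot>\<^bsub>D\<^esub> Q')"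
  by (simp add: op_comp_def monom_comp_plus ring_distribs sum.distrib)

lemma fun_op_comp: "fun_op f \<odot>\<^bsub>D\<^esub> Q = fun_op f * Q"
  by (subst fun_op_def) (simp add: op_comp_single)

lemma one_op_comp [simp]: "1 \<odot>\<^bsub>D\<^esub> Q = Q"
  using fun_op_comp[of 1 Q] by (simp add: fun_op_def)

lemma monom_comp_one: "monom_comp D \<alpha> 1 = Poly_Mapping.single \<alpha> 1"
proof (induction \<alpha> rule: exponent_induct)
  case (single i \<beta>)
  then show ?case
    by (simp del: One_nat_def add: monom_comp_add partial_comp_def partial_op_def mult_single)
qed simp

lemma op_comp_one [simp]: "P \<odot>\<^bsub>D\<^esub> 1 = P"
  by (induction P rule: diffop_induct)
     (simp_all add: op_comp_add_left op_comp_single monom_comp_one fun_op_def mult_single)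

lemma fun_op_comp_fun_op: "fun_op f \<odot>\<^bsub>D\<^esub> fun_op g = fun_op (f * g)"
  by (simp only: fun_op_comp) (simp add: fun_op_def mult_single)

lemma partial_op_comp: "partial_op i \<odot>\<^bsub>D\<^esub> Q = partial_comp D i Q"
  by (subst partial_op_def) (simp del: One_nat_def add: op_comp_single, simp add: fun_op_def)

lemma partial_op_comp_commute:
  "partial_op i \<odot>\<^bsub>D\<^esub> partial_op j = partial_op j \<odot>\<^bsub>D\<^esub> partial_op i"
  by (simp add: partial_op_comp) (simp add: partial_comp_def mult.commute)

lemma partial_op_comp_fun_op:
  "partial_op i \<odot>\<^bsub>D\<^esub> fun_op f = (fun_op f \<odot>\<^bsub>D\<^esub> partial_op i) + fun_op (D i f)"
  by (simp add: partial_op_comp fun_op_comp)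
     (simp add: partial_comp_def fun_op_def mult.commute)

lemma fun_op_mult_comp: "(fun_op f * P) \<odot>\<^bsub>D\<^esub> Q = fun_op f * (P \<odot>\<^bsub>D\<^esub> Q)"
  by (induction P rule: diffop_induct)
     (simp_all add: fun_op_def mult_single op_comp_single op_comp_add_left ring_distribs
        flip: mult.assoc)

lemma partial_comp_op_comp: "partial_comp D i P \<odot>\<^bsub>D\<^esub> Q = partial_comp D i (P \<odot>\<^bsub>D\<^esub> Q)"
proof (induction P rule: diffop_induct)
  case (single \<alpha> a)
  have "partial_comp D i (Poly_Mapping.single \<alpha> a) =
      Poly_Mapping.single \<alpha> (D i a) + Poly_Mapping.single (Poly_Mapping.single i 1 + \<alpha>) a"
    by (simp add: partial_comp_def partial_op_def mult_single)
  then show ?case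
    by (simp del: One_nat_def
        add: op_comp_add_left op_comp_single partial_comp_fun_mult monom_comp_add)
qed (simp_all add: partial_comp_add op_comp_add_left)

lemma monom_comp_op_comp: "monom_comp D \<alpha> P \<odot>\<^bsub>D\<^esub> Q = monom_comp D \<alpha> (P \<odot>\<^bsub>D\<^esub> Q)"
  by (induction \<alpha> rule: exponent_induct)
     (simp_all del: One_nat_def add: monom_comp_add partial_comp_op_comp)

lemma op_comp_assoc: "(P \<odot>\<^bsub>D\<^esub> Q) \<odot>\<^bsub>D\<^esub> R = P \<odot>\<^bsub>D\<^esub> (Q \<odot>\<^bsub>D\<^esub> R)"
  by (induction P rule: diffop_induct)
     (simp_all add: op_comp_add_left op_comp_single fun_op_mult_comp monom_comp_op_comp)

lemma diffop_expansion:
  "P = (\<Sum>\<alpha>\<in>Poly_Mapping.keys P. fun_op (Poly_Mapping.lookup P \<alpha>) \<odot>\<^bsub>D\<^esub> monom_comp D \<alpha> 1)"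
  using op_comp_one[of P] by (simp only: fun_op_comp op_comp_def[of P])

end

end

theory Submission
  imports Defs
begin

text \<open>
  Write \<open>PQ\<close> for the composition of operators. The two recursions are mirror images: from
  \<open>M\<^sub>i = A\<^sub>i\<^sub>+\<^sub>1 M\<^sub>i\<^sub>+\<^sub>1 + M\<^sub>i\<^sub>+\<^sub>2\<close> and \<open>N\<^sub>i = N\<^sub>i\<^sub>+\<^sub>1 A\<^sub>i\<^sub>+\<^sub>1 + N\<^sub>i\<^sub>+\<^sub>2\<close>, both \<open>N\<^sub>i M\<^sub>i\<^sub>+\<^sub>1\<close> and
  \<open>N\<^sub>i\<^sub>+\<^sub>1 M\<^sub>i\<close> contain the term \<open>N\<^sub>i\<^sub>+\<^sub>1 A\<^sub>i\<^sub>+\<^sub>1 M\<^sub>i\<^sub>+\<^sub>1\<close>, and what remains is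
  \<open>N\<^sub>i\<^sub>+\<^sub>2 M\<^sub>i\<^sub>+\<^sub>1\<close> and \<open>N\<^sub>i\<^sub>+\<^sub>1 M\<^sub>i\<^sub>+\<^sub>2\<close>. Hence the relation \<open>N\<^sub>i M\<^sub>i\<^sub>+\<^sub>1 = N\<^sub>i\<^sub>+\<^sub>1 M\<^sub>i\<close> descends from
  \<open>i + 1\<close> to \<open>i\<close>. At \<open>i = k\<close> it reads \<open>c M\<^sub>k c\<^sup>-\<^sup>1 c B = c B M\<^sub>k\<close>, which is the commutation of
  \<open>M\<^sub>k\<close> with \<open>B\<close>; at \<open>i = 0\<close> it is the intertwining relation \<open>L\<^sub>1 M = N L\<close>
  (\<open>intertwining_descends\<close>).

  The same relations give the symbols. The leading parts of \<open>A\<^sub>i M\<^sub>i\<close> and \<open>M\<^sub>i\<^sub>+\<^sub>1\<close> may cancel, so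
  \<open>\<sigma>(N\<^sub>i) = \<sigma>(M\<^sub>i)\<close> cannot be read off the recursions. But \<open>\<sigma>\<close> is multiplicative (\<open>principal_symbol_op_comp\<close>), so
  \<open>\<sigma>(N\<^sub>i) \<sigma>(M\<^sub>i\<^sub>+\<^sub>1) = \<sigma>(N\<^sub>i\<^sub>+\<^sub>1) \<sigma>(M\<^sub>i)\<close>, and if \<open>\<sigma>(N\<^sub>i\<^sub>+\<^sub>1) = \<sigma>(M\<^sub>i\<^sub>+\<^sub>1)\<close>, this nonzero factor cancels
  in the integral domain \<open>K[\<xi>]\<close> (\<open>principal_symbol_cancel\<close>). The descent starts at \<open>i = k\<close>, where
  \<open>c M\<^sub>k c\<^sup>-\<^sup>1\<close> and \<open>M\<^sub>k\<close> have the same symbol.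
\<close>


section \<open>The symbol ring is an integral domain\<close>

text \<open>
  Relabelling of the keys. It serves at two levels: relabelling the variables \<open>\<xi>\<^sub>i\<close> by natural
  numbers acts on exponents, and the resulting map of exponents acts on polynomials.
\<close>

definition push_keys :: "('a \<Rightarrow> 'b) \<Rightarrow> ('a \<Rightarrow>\<^sub>0 'c) \<Rightarrow> ('b \<Rightarrow>\<^sub>0 'c::comm_monoid_add)"
  where "push_keys f p = (\<Sum>a\<in>Poly_Mapping.keys p. Poly_Mapping.single (f a) (Poly_Mapping.lookup p a))"

lemma push_keys_superset:
  assumes "finite S" "Poly_Mapping.keys p \<subseteq> S"
  shows "push_keys f p = (\<Sum>a\<in>S. Poly_Mapping.single (f a) (Poly_Mapping.lookup p a))"
  unfolding push_keys_def using assms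
  by (intro sum.mono_neutral_left) (auto simp: in_keys_iff)

lemma push_keys_0 [simp]: "push_keys f 0 = 0"
  by (simp add: push_keys_def)

lemma push_keys_single [simp]:
  "push_keys f (Poly_Mapping.single a b) = Poly_Mapping.single (f a) b"
  by (cases "b = 0") (auto simp: push_keys_def)

lemma push_keys_add: "push_keys f (p + q) = push_keys f p + push_keys f q"
proof -
  let ?S = "Poly_Mapping.keys p \<union> Poly_Mapping.keys q"
  have "Poly_Mapping.keys (p + q) \<subseteq> ?S" by (rule keys_add)
  then show ?thesis
    by (simp add: push_keys_superset[where S = ?S] lookup_add single_add sum.distrib)
qed

lemma lookup_push_keys:
  assumes "inj f"
  shows "Poly_Mapping.lookup (push_keys f p) (f a) = Poly_Mapping.lookup p a"
proof -
  have "Poly_Mapping.lookup (push_keys f p) (f a) =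
      (\<Sum>b\<in>Poly_Mapping.keys p. if b = a then Poly_Mapping.lookup p b else 0)"
    unfolding push_keys_def lookup_sum
    by (intro sum.cong) (use assms in \<open>auto simp: lookup_single when_def inj_eq\<close>)
  then show ?thesis by (simp add: in_keys_iff)
qed

lemma inj_push_keys: "inj f \<Longrightarrow> inj (push_keys f)"
  by (metis injI lookup_push_keys poly_mapping_eqI)

lemma push_keys_mult:
  fixes P Q :: "('i \<Rightarrow>\<^sub>0 nat) \<Rightarrow>\<^sub>0 'k::comm_semiring_1"
  assumes "\<And>\<alpha> \<beta>. g (\<alpha> + \<beta>) = g \<alpha> + g \<beta>"
  shows "push_keys g (P * Q) = push_keys g P * push_keys g Q"
proof (induction P rule: diffop_induct)
  case (single \<alpha> a)
  show ?case
    by (induction Q rule: diffop_induct)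
       (simp_all add: mult_single assms push_keys_add ring_distribs)
qed (simp_all add: push_keys_add ring_distribs)

text \<open>
  A leading-term argument needs a monomial order, hence a linear order on the variables. The
  finite type \<open>'i\<close> carries none, so the variables are first numbered.
\<close>

lemma symbol_mult_eq_0_iff:
  fixes P Q :: "('i::finite \<Rightarrow>\<^sub>0 nat) \<Rightarrow>\<^sub>0 'k::idom"
  shows "P * Q = 0 \<longleftrightarrow> P = 0 \<or> Q = 0"
proof
  obtain f :: "'i \<Rightarrow> nat" where "inj f"
    using finite_imp_inj_to_nat_seg[OF finite[of "UNIV :: 'i set"]] by blast
  define h :: "(('i \<Rightarrow>\<^sub>0 nat) \<Rightarrow>\<^sub>0 'k) \<Rightarrow> ((nat \<Rightarrow>\<^sub>0 nat) \<Rightarrow>\<^sub>0 'k)"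
    where "h = push_keys (push_keys f)"
  have "inj h"
    unfolding h_def using \<open>inj f\<close> by (intro inj_push_keys)
  then have h_eq_0: "h R = 0 \<longleftrightarrow> R = 0" for R
    by (metis h_def injD push_keys_0)
  assume "P * Q = 0"
  then have "h P * h Q = 0"
    by (metis h_def push_keys_0 push_keys_mult[of "push_keys f", OF push_keys_add])
  then show "P = 0 \<or> Q = 0"
    by (simp add: h_eq_0)
qed auto


section \<open>Multiplicativity of the principal symbol\<close>

lemma multideg_0 [simp]: "multideg 0 = 0"
  by (simp add: multideg_def)

lemma multideg_add: "multideg (\<alpha> + \<beta>) = multideg \<alpha> + multideg \<beta>"
  by (simp add: multideg_def lookup_add sum.distrib)

lemma multideg_single [simp]: "multideg (Poly_Mapping.single i n) = n"
  by (simp add: multideg_def lookup_single when_def)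

text \<open>
  The strict bound \<open>order < d\<close> is used instead of \<open>order \<le> d\<close> since it is also meaningful for
  remainders below a leading part of order \<open>0\<close>, which must vanish.
\<close>

definition order_below :: "nat \<Rightarrow> ('i::finite, 'k::zero) diffop \<Rightarrow> bool"
  where "order_below d P \<longleftrightarrow> (\<forall>\<alpha>\<in>Poly_Mapping.keys P. multideg \<alpha> < d)"

definition homogeneous_of :: "nat \<Rightarrow> ('i::finite, 'k::zero) diffop \<Rightarrow> bool"
  where "homogeneous_of d S \<longleftrightarrow> (\<forall>\<alpha>\<in>Poly_Mapping.keys S. multideg \<alpha> = d)"

lemma order_below_0 [simp]: "order_below d 0"
  by (simp add: order_below_def)

lemma order_below_mono: "order_below d P \<Longrightarrow> d \<le> e \<Longrightarrow> order_below e P"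
  by (force simp: order_below_def)

lemma order_below_add: "order_below d P \<Longrightarrow> order_below d Q \<Longrightarrow> order_below d (P + Q)"
  using keys_add[of P Q] by (auto simp: order_below_def)

lemma order_below_sum: "(\<And>x. x \<in> X \<Longrightarrow> order_below d (F x)) \<Longrightarrow> order_below d (sum F X)"
  by (induction X rule: infinite_finite_induct) (auto intro: order_below_add)

lemma order_below_mult:
  fixes P Q :: "('i::finite, 'k::comm_semiring_1) diffop"
  assumes "order_below (Suc m) P" "order_below n Q"
  shows "order_below (m + n) (P * Q)"
  using assms keys_mult[of P Q] by (fastforce simp: order_below_def multideg_add)

lemma homogeneous_of_mult:
  fixes S T :: "('i::finite, 'k::comm_semiring_1) diffop"
  assumes "homogeneous_of m S" "homogeneous_of n T"
  shows "homogeneous_of (m + n) (S * T)"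
  using assms keys_mult[of S T] by (fastforce simp: homogeneous_of_def multideg_add)

lemma homogeneous_of_imp_order_below: "homogeneous_of d S \<Longrightarrow> order_below (Suc d) S"
  by (simp add: homogeneous_of_def order_below_def)

lemma lookup_principal_symbol:
  "Poly_Mapping.lookup (principal_symbol P) \<alpha> =
    (if multideg \<alpha> = op_order P then Poly_Mapping.lookup P \<alpha> else 0)"
proof -
  let ?K = "{\<beta> \<in> Poly_Mapping.keys P. multideg \<beta> = op_order P}"
  have "Poly_Mapping.lookup (principal_symbol P) \<alpha> =
      (\<Sum>\<beta>\<in>?K. if \<beta> = \<alpha> then Poly_Mapping.lookup P \<beta> else 0)"
    unfolding principal_symbol_def lookup_sum
    by (intro sum.cong) (auto simp: lookup_single when_def)
  then show ?thesis by (auto simp: in_keys_iff)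
qed

lemma multideg_le_op_order: "\<alpha> \<in> Poly_Mapping.keys P \<Longrightarrow> multideg \<alpha> \<le> op_order P"
  unfolding op_order_def by (rule Max_ge) auto

lemma homogeneous_of_principal_symbol: "homogeneous_of (op_order P) (principal_symbol P)"
  by (auto simp: homogeneous_of_def in_keys_iff lookup_principal_symbol split: if_splits)

lemma order_below_diff_principal_symbol:
  fixes P :: "('i::finite, 'k::ab_group_add) diffop"
  shows "order_below (op_order P) (P - principal_symbol P)"
  using multideg_le_op_order[of _ P]
  by (force simp: order_below_def in_keys_iff lookup_minus lookup_principal_symbol
        le_less split: if_splits)

lemma principal_symbol_0 [simp]: "principal_symbol 0 = 0"
  by (simp add: principal_symbol_def)

lemma principal_symbol_eq_0_iff [simp]: "principal_symbol P = 0 \<longleftrightarrow> P = 0"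
proof
  assume *: "principal_symbol P = 0"
  show "P = 0"
  proof (rule ccontr)
    assume "P \<noteq> 0"
    then have "Poly_Mapping.keys P \<noteq> {}" by simp
    then have "op_order P = Max (multideg ` Poly_Mapping.keys P)"
      by (simp add: op_order_def)
    also have "\<dots> \<in> multideg ` Poly_Mapping.keys P"
      using \<open>Poly_Mapping.keys P \<noteq> {}\<close> by (intro Max_in) auto
    finally obtain \<alpha> where "\<alpha> \<in> Poly_Mapping.keys P" "multideg \<alpha> = op_order P"
      by auto
    with * lookup_principal_symbol[of P \<alpha>] show False
      by (simp add: in_keys_iff)
  qed
qed simp

text \<open>
  A nonzero leading part determines the order: the coefficients of \<open>P\<close> and \<open>S\<close> agree in all
  degrees \<open>\<ge> d\<close>, and those of \<open>S\<close> do not all vanish in degree \<open>d\<close>.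
\<close>

lemma principal_symbol_eqI:
  fixes P S :: "('i::finite, 'k::ab_group_add) diffop"
  assumes S: "homogeneous_of d S" "S \<noteq> 0" and "order_below d (P - S)"
  shows "principal_symbol P = S"
proof -
  have eq: "Poly_Mapping.lookup P \<alpha> = Poly_Mapping.lookup S \<alpha>" if "multideg \<alpha> \<ge> d" for \<alpha>
    using assms(3) that by (force simp: order_below_def in_keys_iff lookup_minus)
  obtain \<alpha> where \<alpha>: "\<alpha> \<in> Poly_Mapping.keys S"
    using \<open>S \<noteq> 0\<close> by (metis all_not_in_conv keys_eq_empty)
  have "op_order P \<ge> d"
    using multideg_le_op_order[of \<alpha> P] \<alpha> eq[of \<alpha>] S(1) by (auto simp: homogeneous_of_def in_keys_iff)
  moreover have "multideg \<beta> \<le> d" if "\<beta> \<in> Poly_Mapping.keys P" for \<beta>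
    using that eq[of \<beta>] S(1) by (force simp: homogeneous_of_def in_keys_iff)
  then have "op_order P \<le> d"
    by (auto simp: op_order_def)
  ultimately have "op_order P = d" by simp
  then show ?thesis
    using S(1) by (intro poly_mapping_eqI)
      (auto simp: lookup_principal_symbol eq homogeneous_of_def in_keys_iff)
qed

lemma principal_symbol_fun_op [simp]:
  fixes f :: "'k::ab_group_add"
  shows "principal_symbol (fun_op f :: ('i::finite, 'k) diffop) = fun_op f"
proof (cases "f = 0")
  case False
  then show ?thesis
    by (intro principal_symbol_eqI[of 0])
       (auto simp: homogeneous_of_def fun_op_def simp flip: keys_eq_empty)
qed (simp add: fun_op_def)

context differential_field
begin

lemma order_below_map_D: "order_below d Q \<Longrightarrow> order_below d (Poly_Mapping.map (D i) Q)"
  by (force simp: order_below_def in_keys_iff)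

lemma order_below_partial_comp:
  assumes "order_below d Q"
  shows "order_below (Suc d) (partial_comp D i Q)"
proof -
  have "order_below (Suc 1) (partial_op i :: ('i, 'k) diffop)"
    by (simp add: order_below_def partial_op_def)
  then have "order_below (1 + d) (partial_op i * Q)"
    using assms by (rule order_below_mult)
  with assms show ?thesis
    unfolding partial_comp_def
    by (intro order_below_add order_below_map_D) (auto intro: order_below_mono[of d])
qed

text \<open>
  Composing with one more \<open>\<partial>\<^sub>i\<close> raises the order of the previous discrepancy by one and adds a
  derivative of coefficients, which does not raise the order at all.
\<close>

lemma order_below_monom_comp_diff:
  assumes "order_below (Suc n) Q"
  shows "order_below (multideg \<alpha> + n) (monom_comp D \<alpha> Q - Poly_Mapping.single \<alpha> 1 * Q)"
proof (induction \<alpha> rule: exponent_induct)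
  case zero
  show ?case by simp
next
  case (single i \<beta>)
  let ?X = "Poly_Mapping.single \<beta> 1 :: ('i, 'k) diffop"
  let ?R = "monom_comp D \<beta> Q - ?X * Q"
  have "order_below (Suc (multideg \<beta>)) ?X"
    by (simp add: order_below_def)
  from order_below_mult[OF this assms]
  have "order_below (Suc (multideg \<beta> + n)) (Poly_Mapping.map (D i) (?X * Q))"
    by (intro order_below_map_D) simp
  then have "order_below (Suc (multideg \<beta> + n))
      (partial_comp D i ?R + Poly_Mapping.map (D i) (?X * Q))"
    using single by (intro order_below_add order_below_partial_comp)
  moreover have "partial_comp D i ?R + Poly_Mapping.map (D i) (?X * Q) =
      monom_comp D (Poly_Mapping.single i 1 + \<beta>) Q
        - Poly_Mapping.single (Poly_Mapping.single i 1 + \<beta>) 1 * Q"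
  proof -
    have "partial_comp D i (monom_comp D \<beta> Q) = partial_comp D i ?R + partial_comp D i (?X * Q)"
      by (simp flip: partial_comp_add)
    moreover have "Poly_Mapping.single (Poly_Mapping.single i 1 + \<beta>) 1 = partial_op i * ?X"
      by (simp add: partial_op_def mult_single)
    ultimately show ?thesis
      by (simp only: monom_comp_add monom_comp_single_1 partial_comp_def[of D i "?X * Q"] mult.assoc)
         (simp add: algebra_simps)
  qed
  ultimately show ?case
    by (simp only: multideg_add multideg_single) simp
qed

text \<open>
  To leading order, composition of operators is multiplication of polynomials: the two differ
  only by terms in which a derivation has been spent on a coefficient.
\<close>

lemma order_below_op_comp_diff:
  assumes "order_below (Suc m) P" "order_below (Suc n) Q"
  shows "order_below (m + n) ((P \<odot>\<^bsub>D\<^esub> Q) - P * Q)"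
proof -
  let ?a = "\<lambda>\<alpha>. fun_op (Poly_Mapping.lookup P \<alpha>) :: ('i, 'k) diffop"
  let ?X = "\<lambda>\<alpha>. Poly_Mapping.single \<alpha> 1 :: ('i, 'k) diffop"
  have "P = (\<Sum>\<alpha>\<in>Poly_Mapping.keys P. ?a \<alpha> * ?X \<alpha>)"
    using diffop_expansion[of P] by (simp add: fun_op_comp monom_comp_one)
  then have "P * Q = (\<Sum>\<alpha>\<in>Poly_Mapping.keys P. ?a \<alpha> * ?X \<alpha>) * Q"
    by (rule arg_cong)
  then have "(P \<odot>\<^bsub>D\<^esub> Q) - P * Q =
      (\<Sum>\<alpha>\<in>Poly_Mapping.keys P. ?a \<alpha> * (monom_comp D \<alpha> Q - ?X \<alpha> * Q))"
    by (simp add: op_comp_def sum_distrib_right sum_subtractf right_diff_distrib mult.assoc)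
  moreover have "order_below (m + n) (?a \<alpha> * (monom_comp D \<alpha> Q - ?X \<alpha> * Q))"
    if "\<alpha> \<in> Poly_Mapping.keys P" for \<alpha>
  proof -
    have "order_below (Suc 0) (?a \<alpha>)"
      by (simp add: order_below_def fun_op_def)
    moreover have "order_below (m + n) (monom_comp D \<alpha> Q - ?X \<alpha> * Q)"
      using order_below_monom_comp_diff[OF assms(2), of \<alpha>] assms(1) that
      by (auto simp: order_below_def[of _ P] less_Suc_eq_le intro: order_below_mono)
    ultimately show ?thesis
      using order_below_mult[of 0] by fastforce
  qed
  ultimately show ?thesis
    by (simp add: order_below_sum)
qed

lemma principal_symbol_op_comp:
  "principal_symbol (P \<odot>\<^bsub>D\<^esub> Q) = principal_symbol P * principal_symbol Q"
proof (cases "P = 0 \<or> Q = 0")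
  case True
  moreover have "P \<odot>\<^bsub>D\<^esub> 0 = 0"
    using op_comp_add_right[of P 0 0] by simp
  ultimately show ?thesis by auto
next
  case False
  define m n S T where "m = op_order P" and "n = op_order Q"
    and "S = principal_symbol P" and "T = principal_symbol Q"
  have hom: "homogeneous_of m S" "homogeneous_of n T"
    by (simp_all add: m_def n_def S_def T_def homogeneous_of_principal_symbol)
  have rest: "order_below m (P - S)" "order_below n (Q - T)"
    by (simp_all add: m_def n_def S_def T_def order_below_diff_principal_symbol)
  have P: "order_below (Suc m) P" and Q: "order_below (Suc n) Q"
    by (auto simp: m_def n_def order_below_def less_Suc_eq_le multideg_le_op_order)
  \<comment> \<open>The factor of strictly smaller order comes second, as in \<open>order_below_mult\<close>.\<close>
  have "order_below (n + m) (Q * (P - S))"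
    using Q rest(1) by (rule order_below_mult)
  moreover have "order_below (m + n) (S * (Q - T))"
    using homogeneous_of_imp_order_below[OF hom(1)] rest(2) by (rule order_below_mult)
  moreover have "(P \<odot>\<^bsub>D\<^esub> Q) - S * T = ((P \<odot>\<^bsub>D\<^esub> Q) - P * Q) + (Q * (P - S) + S * (Q - T))"
    by (simp add: algebra_simps)
  ultimately have "order_below (m + n) ((P \<odot>\<^bsub>D\<^esub> Q) - S * T)"
    using order_below_op_comp_diff[OF P Q] by (simp only: order_below_add add.commute[of n m])
  moreover have "S * T \<noteq> 0"
    using False by (simp add: symbol_mult_eq_0_iff S_def T_def)
  ultimately have "principal_symbol (P \<odot>\<^bsub>D\<^esub> Q) = S * T"
    using homogeneous_of_mult[OF hom] by (intro principal_symbol_eqI)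
  then show ?thesis
    by (simp add: S_def T_def)
qed

text \<open>
  The relation \<open>N M' = N' M\<close> forces equality of symbols to propagate from \<open>(M', N')\<close> to
  \<open>(M, N)\<close>, whatever cancellation of leading parts occurred in the construction of \<open>M\<close> and \<open>N\<close>.
\<close>

lemma principal_symbol_cancel:
  assumes "N \<odot>\<^bsub>D\<^esub> M' = N' \<odot>\<^bsub>D\<^esub> M"
    and "principal_symbol M' = principal_symbol N'" and "M' \<noteq> 0"
  shows "principal_symbol M = principal_symbol N"
proof -
  have "principal_symbol N * principal_symbol M' = principal_symbol N' * principal_symbol M"
    using assms(1) by (metis principal_symbol_op_comp)
  then have "principal_symbol M' * (principal_symbol M - principal_symbol N) = 0"
    using assms(2) by (simp add: algebra_simps)
  then show ?thesis
    using assms(3) by (simp add: symbol_mult_eq_0_iff)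
qed


section \<open>Descent of the intertwining relation\<close>

text \<open>
  The start of the descent. The commutation of \<open>M'\<close> with \<open>B\<close> is what makes \<open>c B\<close> intertwine \<open>M'\<close> with its conjugate.
\<close>

lemma intertwining_conjugate:
  assumes "M' \<odot>\<^bsub>D\<^esub> B = B \<odot>\<^bsub>D\<^esub> M'" and "c \<noteq> 0"
  shows "(fun_op c \<odot>\<^bsub>D\<^esub> M' \<odot>\<^bsub>D\<^esub> fun_op (inverse c)) \<odot>\<^bsub>D\<^esub> (fun_op c \<odot>\<^bsub>D\<^esub> B) =
    (fun_op c \<odot>\<^bsub>D\<^esub> B) \<odot>\<^bsub>D\<^esub> M'"
proof -
  have "fun_op (inverse c) \<odot>\<^bsub>D\<^esub> (fun_op c \<odot>\<^bsub>D\<^esub> B) = B"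
  proof -
    have "fun_op (inverse c) \<odot>\<^bsub>D\<^esub> (fun_op c \<odot>\<^bsub>D\<^esub> B) = (1 :: ('i, 'k) diffop) \<odot>\<^bsub>D\<^esub> B"
      using \<open>c \<noteq> 0\<close> by (simp only: fun_op_comp_fun_op flip: op_comp_assoc) (simp add: fun_op_def)
    then show ?thesis by simp
  qed
  then show ?thesis
    by (simp add: op_comp_assoc assms(1))
qed

lemma principal_symbol_conjugate:
  assumes "c \<noteq> 0"
  shows "principal_symbol (fun_op c \<odot>\<^bsub>D\<^esub> P \<odot>\<^bsub>D\<^esub> fun_op (inverse c)) = principal_symbol P"
proof -
  have "fun_op c * fun_op (inverse c) = (1 :: ('i, 'k) diffop)"
    using assms by (simp add: fun_op_def mult_single)
  then show ?thesis
    by (simp add: principal_symbol_op_comp) (metis mult.commute mult.left_commute mult.right_neutral)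
qed

text \<open>
  Both products contain \<open>N' A M'\<close>; the remaining terms agree by the previous relation.
\<close>

lemma intertwining_descends:
  assumes "M = (A \<odot>\<^bsub>D\<^esub> M') + M''" and "N = (N' \<odot>\<^bsub>D\<^esub> A) + N''"
    and "N' \<odot>\<^bsub>D\<^esub> M'' = N'' \<odot>\<^bsub>D\<^esub> M'"
  shows "N \<odot>\<^bsub>D\<^esub> M' = N' \<odot>\<^bsub>D\<^esub> M"
  using assms by (simp add: op_comp_add_left op_comp_add_right op_comp_assoc)

end

theorem theorem6p1:
  fixes D :: "'i::finite \<Rightarrow> 'k::field_char_0 \<Rightarrow> 'k"
    and k :: nat
    and Ms A Ns :: "nat \<Rightarrow> ('i, 'k) diffop"
    and L M N L\<^sub>1 B :: "('i, 'k) diffop"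
    and c :: 'k
  assumes "differential_field D"
    and "k \<ge> 1"
    and "L = Ms 0" and "M = Ms 1"
    and "\<forall>i\<in>{0..k+1}. Ms i \<noteq> 0"
    and "\<forall>i\<in>{1..k}. A i \<noteq> 0"
    and "\<forall>i\<in>{1..k}. Ms (i - 1) = (A i \<odot>\<^bsub>D\<^esub> Ms i) + Ms (i + 1)"
    and "Ms (k + 1) = fun_op c \<odot>\<^bsub>D\<^esub> B"
    and "Ms (k + 1) \<notin> range fun_op"
    and "Ms k \<odot>\<^bsub>D\<^esub> B = B \<odot>\<^bsub>D\<^esub> Ms k"
    and "Ns (k + 1) = Ms (k + 1)"
    and "Ns k = fun_op c \<odot>\<^bsub>D\<^esub> Ms k \<odot>\<^bsub>D\<^esub> fun_op (inverse c)"
    and "\<forall>i\<in>{0..k-1}. Ns i = (Ns (i + 1) \<odot>\<^bsub>D\<^esub> A (i + 1)) + Ns (i + 2)"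
    and "N = Ns 1" and "L\<^sub>1 = Ns 0"
  shows "principal_symbol M = principal_symbol N \<and> darboux_transformation D M N L L\<^sub>1"
proof -
  interpret differential_field D by fact
  have "c \<noteq> 0"
    using assms(5,8) by (auto simp: fun_op_def)
  have descent: "Ns i \<odot>\<^bsub>D\<^esub> Ms (i + 1) = Ns (i + 1) \<odot>\<^bsub>D\<^esub> Ms i \<and>
      principal_symbol (Ms i) = principal_symbol (Ns i)" if "i \<le> k" for i
    using that
  proof (induction i rule: inc_induct)
    case base
    show ?case
      using intertwining_conjugate[OF assms(10) \<open>c \<noteq> 0\<close>]
      by (simp only: assms(8,11,12) principal_symbol_conjugate[OF \<open>c \<noteq> 0\<close>] simp_thms)
  next
    case (step i)
    have "Ms i = (A (i + 1) \<odot>\<^bsub>D\<^esub> Ms (i + 1)) + Ms (i + 2)"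
      using assms(7)[rule_format, of "i + 1"] step.hyps by simp
    moreover have "Ns i = (Ns (i + 1) \<odot>\<^bsub>D\<^esub> A (i + 1)) + Ns (i + 2)"
      using assms(13)[rule_format, of i] step.hyps by simp
    moreover have "Ns (i + 1) \<odot>\<^bsub>D\<^esub> Ms (i + 2) = Ns (i + 2) \<odot>\<^bsub>D\<^esub> Ms (i + 1)"
      using step.IH by simp
    ultimately have "Ns i \<odot>\<^bsub>D\<^esub> Ms (i + 1) = Ns (i + 1) \<odot>\<^bsub>D\<^esub> Ms i"
      by (rule intertwining_descends)
    moreover from this have "principal_symbol (Ms i) = principal_symbol (Ns i)"
      using step assms(5) by (intro principal_symbol_cancel[of "Ns i" "Ms (i + 1)"]) auto
    ultimately show ?case by blast
  qed
  show ?thesis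
    using descent[of 0] descent[of 1] \<open>k \<ge> 1\<close>
    by (simp add: darboux_transformation_def assms(3,4,14,15))
qed

end
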